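(* Let $\Omega=\{a_1,\dots,a_n\}$ be a set of $n$ distinct elements with the $\sigma$-algebra $\mathcal F=\mathcal P(\Omega)$, and let $b_1,\dots,b_N:\Omega\to\mathbb R$ be functions written as $b_k=\sum_{j=1}^{n_k}x_j^k\,1_{A_j^k}$, where for each $k$ the sets $A_1^k,\dots,A_{n_k}^k$ form a partition of $\Omega$ and $x_j^k\in\mathbb R$. Put $I_j^k=\{l\in\{1,\dots,n\}: a_l\in A_j^k\}$. Suppose that 1. for every $(j_1,\dots,j_N)\in\{1,\dots,n_1\}\times\cdots\times\{1,\dots,n_N\}$ one has $\bigcap_{k=1}^N I_{j_k}^k\neq\emptyset$; and let $(p_1,\dots,p_n)\in\,]0,1[^n$ with $\sum_{l=1}^n p_l=1$ be such that 2. for every $(j_1,\dots,j_N)\in\{1,\dots,n_1\}\times\cdots\times\{1,\dots,n_N\}$, $$\prod_{k=1}^N\ \sum_{l\in I_{j_k}^k}p_l=\sum_{l\in\bigcap_{k=1}^N I_{j_k}^k}p_l .$$ Then the random variables $b_1,\dots,b_N$ are mutually independent on the probability space $(\Omega,\mathcal F,P)$, where $P=\sum_{k=1}^n p_k\,\delta_{a_k}$.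
   Context: $\delta_a$ denotes the Dirac mass at $a$, and $1_A$ the indicator function of $A$. *)

theory Defs
  imports "HOL-Probability.Probability"
begin

text \<open>
  The measure \<open>\<Sum>k=1..n. p k * \<delta>\<^bsub>a k\<^esub>\<close> on the power set of \<open>{a 1, \<dots>, a n}\<close>. The Dirac mass at a
  point of \<open>\<Omega>\<close> is \<^const>\<open>return\<close> over \<^term>\<open>count_space \<Omega>\<close>, whose \<open>\<sigma>\<close>-algebra is the power
  set of \<open>\<Omega>\<close>. Since \<^const>\<open>measure_of\<close> falls back to the zero measure when the given set function
  is not a measure, \<open>emeasure_dirac_sum\<close> below checks that this does not happen.
\<close>

definition dirac_sum :: "nat \<Rightarrow> (nat \<Rightarrow> real) \<Rightarrow> (nat \<Rightarrow> 'a) \<Rightarrow> 'a measure" where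
  "dirac_sum n p a =
     (let \<Omega> = a ` {1..n} in
      measure_of \<Omega> (Pow \<Omega>)
        (\<lambda>S. \<Sum>k = 1..n. ennreal (p k) * emeasure (return (count_space \<Omega>) (a k)) S))"

lemma space_dirac_sum: "space (dirac_sum n p a) = a ` {1..n}"
  by (simp add: dirac_sum_def Let_def space_measure_of_conv)

lemma sets_dirac_sum: "sets (dirac_sum n p a) = Pow (a ` {1..n})"
  by (simp add: dirac_sum_def Let_def sigma_algebra.sigma_sets_eq sigma_algebra_Pow)

lemma emeasure_dirac_sum:
  assumes "S \<subseteq> a ` {1..n}"
  shows "emeasure (dirac_sum n p a) S = (\<Sum>k = 1..n. ennreal (p k) * indicator S (a k))"
proof -
  let ?\<Omega> = "a ` {1..n}"
  let ?\<mu> = "\<lambda>S. \<Sum>k = 1..n. ennreal (p k) * emeasure (return (count_space ?\<Omega>) (a k)) S"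
  have "emeasure (dirac_sum n p a) S = ?\<mu> S"
    unfolding dirac_sum_def Let_def
  proof (rule emeasure_measure_of_sigma)
    show "sigma_algebra ?\<Omega> (Pow ?\<Omega>)" by (rule sigma_algebra_Pow)
    show "positive (Pow ?\<Omega>) ?\<mu>" by (simp add: positive_def)
    show "countably_additive (Pow ?\<Omega>) ?\<mu>"
    proof (rule countably_additiveI)
      fix F :: "nat \<Rightarrow> 'a set"
      assume F: "range F \<subseteq> Pow ?\<Omega>" "disjoint_family F"
      have "(\<Sum>i. ?\<mu> (F i)) =
          (\<Sum>k = 1..n. \<Sum>i. ennreal (p k) * emeasure (return (count_space ?\<Omega>) (a k)) (F i))"
        by (rule suminf_sum) simp
      also have "\<dots> = ?\<mu> (\<Union>i. F i)"
        using F by (intro sum.cong refl) (simp add: suminf_emeasure)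
      finally show "(\<Sum>i. ?\<mu> (F i)) = ?\<mu> (\<Union>i. F i)" .
    qed
    show "S \<in> Pow ?\<Omega>" using assms by simp
  qed
  also have "\<dots> = (\<Sum>k = 1..n. ennreal (p k) * indicator S (a k))"
    using assms by (intro sum.cong refl) simp
  finally show ?thesis .
qed

definition index_set :: "nat \<Rightarrow> (nat \<Rightarrow> 'a) \<Rightarrow> 'a set \<Rightarrow> nat set" where
  "index_set n a B = {l \<in> {1..n}. a l \<in> B}"

end

theory Submission
  imports Defs
begin

text \<open>
  The cells of each partition resolve every event \<open>b k \<in> B k\<close> into a disjoint union of cells.
  Expanding \<open>\<Prod>k. P (b k \<in> B k)\<close> by distributivity therefore gives a sum over choices of one cell
  per partition, and the product formula for cells turns each summand into the probability of an
  intersection of cells; these intersections are disjoint with union \<open>\<Inter>k. {b k \<in> B k}\<close>.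
\<close>

lemma (in prob_space) indep_vars_partitionI:
  fixes A :: "'i \<Rightarrow> 'j \<Rightarrow> 'a set"
  assumes I: "finite I" "I \<noteq> {}"
    and fin: "\<And>k. k \<in> I \<Longrightarrow> finite (L k)"
    and rv: "\<And>k. k \<in> I \<Longrightarrow> random_variable (M' k) (X k)"
    and ev: "\<And>k j. k \<in> I \<Longrightarrow> j \<in> L k \<Longrightarrow> A k j \<in> events"
    and disj: "\<And>k. k \<in> I \<Longrightarrow> disjoint_family_on (A k) (L k)"
    and cover: "\<And>k. k \<in> I \<Longrightarrow> (\<Union>j\<in>L k. A k j) = space M"
    and X: "\<And>k j \<omega>. k \<in> I \<Longrightarrow> j \<in> L k \<Longrightarrow> \<omega> \<in> A k j \<Longrightarrow> X k \<omega> = x k j"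
    and prod: "\<And>j. j \<in> Pi\<^sub>E I L \<Longrightarrow> (\<Prod>k\<in>I. prob (A k (j k))) = prob (\<Inter>k\<in>I. A k (j k))"
  shows "indep_vars M' X I"
proof -
  \<comment> \<open>The sets \<open>B k\<close> can be arbitrary here: for \<open>k \<in> I\<close>,
    the preimage under \<open>X k\<close> is a finite union of cells, hence an event.\<close>
  have "prob (\<Inter>k\<in>I. X k -` B k \<inter> space M) = (\<Prod>k\<in>I. prob (X k -` B k \<inter> space M))"
    for B :: "'i \<Rightarrow> 'b set"
  proof -
    \<comment> \<open>Cells are selected by index rather than by value, since distinct cells may
      carry the same value \<open>x k j\<close>.\<close>
    define J where "J k = {j \<in> L k. x k j \<in> B k}" for k
    have sub: "Pi\<^sub>E I J \<subseteq> Pi\<^sub>E I L"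
      by (auto simp: J_def)
    have finJ: "finite (J k)" if "k \<in> I" for k
      using fin[OF that] by (simp add: J_def)
    have S: "X k -` B k \<inter> space M = (\<Union>j\<in>J k. A k j)" if k: "k \<in> I" for k
    proof -
      have "\<omega> \<in> X k -` B k \<longleftrightarrow> x k j \<in> B k" if "j \<in> L k" "\<omega> \<in> A k j" for j \<omega>
        using X[OF k that] by simp
      then show ?thesis
        unfolding cover[OF k, symmetric] J_def by blast
    qed
    have cells: "(\<Inter>k\<in>I. X k -` B k \<inter> space M) = (\<Union>j\<in>Pi\<^sub>E I J. \<Inter>k\<in>I. A k (j k))"
    proof (intro set_eqI iffI)
      fix \<omega> assume "\<omega> \<in> (\<Inter>k\<in>I. X k -` B k \<inter> space M)"
      then have "\<forall>k\<in>I. \<exists>j. j \<in> J k \<and> \<omega> \<in> A k j"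
        using S by auto
      then obtain j where "\<forall>k\<in>I. j k \<in> J k \<and> \<omega> \<in> A k (j k)"
        by (auto dest!: bchoice)
      then show "\<omega> \<in> (\<Union>j\<in>Pi\<^sub>E I J. \<Inter>k\<in>I. A k (j k))"
        \<comment> \<open>The choice function is arbitrary outside \<open>I\<close>; restricting it
          gives the extensional representative that \<open>Pi\<^sub>E\<close> requires.\<close>
        by (intro UN_I[of "restrict j I"]) auto
    next
      fix \<omega> assume "\<omega> \<in> (\<Union>j\<in>Pi\<^sub>E I J. \<Inter>k\<in>I. A k (j k))"
      then show "\<omega> \<in> (\<Inter>k\<in>I. X k -` B k \<inter> space M)"
        using S by (auto simp: PiE_iff)
    qed
    have disj_cells: "disjoint_family_on (\<lambda>j. \<Inter>k\<in>I. A k (j k)) (Pi\<^sub>E I J)"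
    proof (unfold disjoint_family_on_def, intro ballI impI)
      fix i j assume ij: "i \<in> Pi\<^sub>E I J" "j \<in> Pi\<^sub>E I J" "i \<noteq> j"
      \<comment> \<open>Extensional functions that differ must differ at a point of
        \<open>I\<close>. There they pick two disjoint cells of one partition, which separates the
        two intersections.\<close>
      then obtain k where k: "k \<in> I" "i k \<noteq> j k"
        by (meson PiE_ext)
      moreover have "i k \<in> L k" "j k \<in> L k"
        using ij k by (auto simp: PiE_iff J_def)
      ultimately have "A k (i k) \<inter> A k (j k) = {}"
        using disj[OF k(1)] by (simp add: disjoint_family_on_def)
      then show "(\<Inter>k\<in>I. A k (i k)) \<inter> (\<Inter>k\<in>I. A k (j k)) = {}"
        using k by blast
    qed
    have "(\<Prod>k\<in>I. prob (X k -` B k \<inter> space M)) = (\<Prod>k\<in>I. \<Sum>j\<in>J k. prob (A k j))"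
    proof (rule prod.cong[OF refl])
      fix k assume k: "k \<in> I"
      have "disjoint_family_on (A k) (J k)"
        using disj[OF k] by (rule disjoint_family_on_mono[rotated]) (auto simp: J_def)
      then show "prob (X k -` B k \<inter> space M) = (\<Sum>j\<in>J k. prob (A k j))"
        unfolding S[OF k] using ev[OF k] finJ[OF k]
        by (intro finite_measure_finite_Union) (auto simp: J_def)
    qed
    also have "\<dots> = (\<Sum>j\<in>Pi\<^sub>E I J. \<Prod>k\<in>I. prob (A k (j k)))"
      using I finJ by (intro prod_sum_PiE) auto
    also have "\<dots> = (\<Sum>j\<in>Pi\<^sub>E I J. prob (\<Inter>k\<in>I. A k (j k)))"
      using sub prod by (intro sum.cong) auto
    also have "\<dots> = prob (\<Union>j\<in>Pi\<^sub>E I J. \<Inter>k\<in>I. A k (j k))"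
    proof (rule finite_measure_finite_Union[symmetric])
      show "finite (Pi\<^sub>E I J)"
        using I finJ by (intro finite_PiE) auto
      show "(\<lambda>j. \<Inter>k\<in>I. A k (j k)) ` Pi\<^sub>E I J \<subseteq> events"
        using I ev PiE_mem[OF subsetD[OF sub]] by (intro image_subsetI sets.finite_INT) auto
    qed (rule disj_cells)
    finally show ?thesis
      by (simp only: cells)
  qed
  \<comment> \<open>For finite \<open>I\<close>, independence follows from factorization over all of
    \<open>I\<close> on intersection-stable generators containing the whole space. The full
    \<sigma>-algebra \<open>sets (M' k)\<close> serves as its own generator.\<close>
  moreover have "sets (M' k) = sigma_sets (space (M' k)) (sets (M' k))" for k
    by (rule sets.sigma_sets_eq[symmetric])
  ultimately show ?thesis
    using I rv sets.Int_stable sets.top sets.space_closed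
    by (subst indep_vars_finite[where E = "\<lambda>k. sets (M' k)" and I = I]) blast+
qed

text \<open>The index \<open>l\<close> contributes its mass \<open>p l\<close> exactly when
  \<open>a l\<close> lies in \<open>S\<close>. This is the bridge from the index sums in the product
  hypothesis to probabilities of cells; nonnegativity lets the sum move inside
  \<open>ennreal\<close>.\<close>

lemma measure_dirac_sum:
  assumes "S \<subseteq> a ` {1..n}" and "\<And>l. l \<in> {1..n} \<Longrightarrow> 0 \<le> p l"
  shows "measure (dirac_sum n p a) S = (\<Sum>l\<in>index_set n a S. p l)"
proof -
  have "emeasure (dirac_sum n p a) S = (\<Sum>l = 1..n. ennreal (p l * indicator S (a l)))"
    using assms by (simp add: emeasure_dirac_sum ennreal_mult' ennreal_indicator)
  also have "\<dots> = ennreal (\<Sum>l = 1..n. p l * indicator S (a l))"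
    using assms by (intro sum_ennreal) simp
  also have "(\<Sum>l = 1..n. p l * indicator S (a l)) = (\<Sum>l\<in>index_set n a S. p l)"
    by (auto simp: index_set_def indicator_def intro!: sum.mono_neutral_cong_right)
  finally show ?thesis
    using assms(2) by (intro measure_eq_emeasure_eq_ennreal sum_nonneg) (auto simp: index_set_def)
qed

lemma prob_space_dirac_sum:
  assumes "\<And>l. l \<in> {1..n} \<Longrightarrow> 0 \<le> p l" and "(\<Sum>l = 1..n. p l) = 1"
  shows "prob_space (dirac_sum n p a)"
proof
  have "emeasure (dirac_sum n p a) (a ` {1..n}) = (\<Sum>l = 1..n. ennreal (p l))"
    by (simp add: emeasure_dirac_sum)
  also have "\<dots> = 1"
    using assms by (subst sum_ennreal) auto
  finally show "emeasure (dirac_sum n p a) (space (dirac_sum n p a)) = 1"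
    by (simp add: space_dirac_sum)
qed

text \<open>For empty \<open>I\<close> both intersections are \<open>UNIV\<close>, but only the left
  one is cut down to \<open>{1..n}\<close>; hence the nonemptiness condition.\<close>

lemma index_set_INT:
  "I \<noteq> {} \<Longrightarrow> index_set n a (\<Inter>k\<in>I. B k) = (\<Inter>k\<in>I. index_set n a (B k))"
  by (auto simp: index_set_def)

theorem proposition1p2p1:
  fixes a :: "nat \<Rightarrow> 'a" and n N :: nat
    and b :: "nat \<Rightarrow> 'a \<Rightarrow> real"
    and m :: "nat \<Rightarrow> nat"
    and x :: "nat \<Rightarrow> nat \<Rightarrow> real"
    and A :: "nat \<Rightarrow> nat \<Rightarrow> 'a set"
    and p :: "nat \<Rightarrow> real"
  assumes "1 \<le> N"
    and "inj_on a {1..n}"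
    and "\<And>k. k \<in> {1..N} \<Longrightarrow> inj_on (A k) {1..m k}"
    and "\<And>k. k \<in> {1..N} \<Longrightarrow> partition_on (a ` {1..n}) (A k ` {1..m k})"
    and "\<And>k \<omega>. k \<in> {1..N} \<Longrightarrow> \<omega> \<in> a ` {1..n} \<Longrightarrow>
           b k \<omega> = (\<Sum>j = 1..m k. x k j * indicator (A k j) \<omega>)"
    and "\<And>j. j \<in> (\<Pi>\<^sub>E k\<in>{1..N}. {1..m k}) \<Longrightarrow>
           (\<Inter>k\<in>{1..N}. index_set n a (A k (j k))) \<noteq> {}"
    and "\<And>l. l \<in> {1..n} \<Longrightarrow> p l \<in> {0<..<1}"
    and "(\<Sum>l = 1..n. p l) = 1"
    and "\<And>j. j \<in> (\<Pi>\<^sub>E k\<in>{1..N}. {1..m k}) \<Longrightarrow>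
           (\<Prod>k = 1..N. \<Sum>l\<in>index_set n a (A k (j k)). p l) =
           (\<Sum>l\<in>(\<Inter>k\<in>{1..N}. index_set n a (A k (j k))). p l)"
  shows "prob_space (dirac_sum n p a) \<and>
         prob_space.indep_vars (dirac_sum n p a) (\<lambda>_. borel) b {1..N}"
proof
  let ?P = "dirac_sum n p a"
  have p0: "0 \<le> p l" if "l \<in> {1..n}" for l
    using assms(7)[OF that] by simp
  show "prob_space ?P"
    using p0 assms(8) by (rule prob_space_dirac_sum)
  then interpret prob_space ?P .
  have sub: "A k j \<subseteq> a ` {1..n}" if "k \<in> {1..N}" "j \<in> {1..m k}" for k j
    using assms(4)[OF that(1)] that(2) by (auto simp: partition_on_def)
  \<comment> \<open>\<open>partition_on\<close> speaks about the set of cells. Injectivity of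
    \<open>A k\<close> ensures that different indices name different cells, so the indexed family is
    disjoint too.\<close>
  have disj: "disjoint_family_on (A k) {1..m k}" if "k \<in> {1..N}" for k
    using partition_onD2[OF assms(4)[OF that]] assms(3)[OF that]
    by (intro disjoint_image_disjoint_family_on)
  show "indep_vars (\<lambda>_. borel) b {1..N}"
  proof (rule indep_vars_partitionI[where L = "\<lambda>k. {1..m k}" and A = A and x = x])
    fix k assume "k \<in> {1..N}"
    then show "(\<Union>j\<in>{1..m k}. A k j) = space ?P"
      using assms(4) by (simp add: partition_on_def space_dirac_sum)
  next
    fix k j \<omega> assume k: "k \<in> {1..N}" and j: "j \<in> {1..m k}" and \<omega>: "\<omega> \<in> A k j"
    have "b k \<omega> = (\<Sum>i = 1..m k. x k i * indicator (A k i) \<omega>)"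
      using sub[OF k j] \<omega> by (intro assms(5)[OF k]) auto
    \<comment> \<open>Since \<omega> lies in cell \<open>j\<close>, disjointness makes every other
      indicator vanish at \<omega>.\<close>
    also have "\<dots> = (\<Sum>i = 1..m k. if i = j then x k i else 0)"
      using disjoint_family_onD[OF disj[OF k]] j \<omega>
      by (intro sum.cong) (auto simp: indicator_def disjoint_iff)
    also have "\<dots> = x k j"
      using j by simp
    finally show "b k \<omega> = x k j" .
  next
    fix j assume j: "j \<in> (\<Pi>\<^sub>E k\<in>{1..N}. {1..m k})"
    have sub_j: "A k (j k) \<subseteq> a ` {1..n}" if "k \<in> {1..N}" for k
      using that PiE_mem[OF j that] by (rule sub)
    have N: "{1..N} \<noteq> {}"
      using assms(1) by simp
    have "(\<Prod>k\<in>{1..N}. prob (A k (j k))) = (\<Prod>k = 1..N. \<Sum>l\<in>index_set n a (A k (j k)). p l)"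
      by (intro prod.cong refl measure_dirac_sum sub_j p0)
    also have "\<dots> = (\<Sum>l\<in>(\<Inter>k\<in>{1..N}. index_set n a (A k (j k))). p l)"
      by (rule assms(9)[OF j])
    also have "\<dots> = (\<Sum>l\<in>index_set n a (\<Inter>k\<in>{1..N}. A k (j k)). p l)"
      by (simp only: index_set_INT[OF N])
    \<comment> \<open>With \<open>1 \<le> N\<close>, the intersection is over a nonempty family of
      subsets of the sample space and so is itself such a subset.\<close>
    also have "\<dots> = prob (\<Inter>k\<in>{1..N}. A k (j k))"
      using N sub_j by (intro measure_dirac_sum[symmetric] p0) blast+
    finally show "(\<Prod>k\<in>{1..N}. prob (A k (j k))) = prob (\<Inter>k\<in>{1..N}. A k (j k))" .
  next
    fix k j assume "k \<in> {1..N}" "j \<in> {1..m k}"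
    then show "A k j \<in> events"
      using sub by (simp add: sets_dirac_sum)
  next
    fix k assume "k \<in> {1..N}"
    show "random_variable borel (b k)"
      \<comment> \<open>Every subset of the sample space is an event, so any real function on it is
        measurable.\<close>
      by (auto simp: measurable_def sets_dirac_sum space_dirac_sum)
  qed (use assms(1) disj in simp_all)
qed

end
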